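(* Let $T$ be a tree with a fixed vertex $x_0$ and heat kernel $p_t$, and let $T_n$ be a model tree with branching function $n(r)$ and radial heat kernel $\rho_t(r)$. Let $M(r)=\max_{x\in S_r(x_0)}m(x)$, where $S_r(x_0)$ is the sphere in $T$ and $m(x)$ is the valence in $T$. If $$M(r)\le n(r)+1\quad\text{for all } r>0,$$ then $$\rho_t(r)\le p_t(x_0,x)$$ for all $x\in S_r(x_0)\subset T$.
   Context: All graphs are infinite, locally finite and connected; $d(x,y)$ is the number of edges in a shortest path from $x$ to $y$, $m(x)$ is the valence (number of edges at $x$), $y\sim x$ means $x,y$ are joined by an edge, and $S_r(x_0)=\{x: d(x,x_0)=r\}$. A tree is called model if it contains a vertex, the root, such that the valence is constant, say equal to $m(r)$, on each sphere of radius $r$ about the root. Its branching function is $n(r)=m(r)-1$ for $r>0$, and $n(0)=m(0)$ is the valence of the root; the tree is denoted $T_n$. The root of $T_n$ is also denoted $x_0$. The combinatorial Laplacian is $\Delta f(x)=\sum_{y\sim x}(f(x)-f(y))$. The heat kernel $p_t(x,y)$ of a graph with vertex set $V$ is the smallest non-negative function on $V\times V\times[0,\infty)$ which is smooth in $t$, satisfies $\Delta p+\frac{\partial p}{\partial t}=0$ (with $\Delta$ in either vertex variable) and $p_0(x,y)=\delta_x(y)$, where $\delta_x(y)=1$ if $x=y$ and $0$ otherwise. On $T_n$ the heat kernel from the root to a vertex depends only on the distance of that vertex from the root; $\rho_t(r)$ denotes the common value at time $t$ of the heat kernel of $T_n$ between the root and the vertices at distance $r$ from the root.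
   Formalization: The formal theorem also assumes m(x_0) ≤ n(0), the valence bound at the root (r = 0); without it the claim fails (T three rays glued at x_0, T_n a single ray), and the conclusion at r = 0 for small t forces it. *)

theory Defs
  imports "HOL-Analysis.Analysis"
begin

text \<open>
  A simple graph is its adjacency relation; the vertex set is the whole type. Trees have
  no loops or multiple edges, so simple graphs suffice.
\<close>

type_synonym 'a adjacency = "'a \<Rightarrow> 'a \<Rightarrow> bool"

definition nbrs :: "'a adjacency \<Rightarrow> 'a \<Rightarrow> 'a set" where
  "nbrs E x = {y. E x y}"

definition valence :: "'a adjacency \<Rightarrow> 'a \<Rightarrow> nat" where
  "valence E x = card (nbrs E x)"

definition infinite_graph :: "'a adjacency \<Rightarrow> bool" where
  "infinite_graph E \<longleftrightarrow>
     symp E \<and> irreflp E \<and>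
     infinite (UNIV :: 'a set) \<and>
     (\<forall>x. finite (nbrs E x)) \<and>
     (\<forall>x y. rtranclp E x y)"

definition is_cycle :: "'a adjacency \<Rightarrow> 'a list \<Rightarrow> bool" where
  "is_cycle E c \<longleftrightarrow> length c \<ge> 3 \<and> distinct c \<and> successively E c \<and> E (last c) (hd c)"

definition infinite_tree :: "'a adjacency \<Rightarrow> bool" where
  "infinite_tree E \<longleftrightarrow> infinite_graph E \<and> (\<nexists>c. is_cycle E c)"

text \<open>\<open>(E ^^ k) x y\<close> says that there is a walk with \<open>k\<close> edges; shortest walks are paths.\<close>

definition graph_dist :: "'a adjacency \<Rightarrow> 'a \<Rightarrow> 'a \<Rightarrow> nat" where
  "graph_dist E x y = (LEAST k. (E ^^ k) x y)"

definition gsphere :: "'a adjacency \<Rightarrow> 'a \<Rightarrow> nat \<Rightarrow> 'a set" where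
  "gsphere E x0 r = {x. graph_dist E x x0 = r}"

text \<open>In an infinite, locally finite, connected graph every sphere is finite and nonempty.\<close>

definition max_valence :: "'a adjacency \<Rightarrow> 'a \<Rightarrow> nat \<Rightarrow> nat" where
  "max_valence E x0 r = Max (valence E ` gsphere E x0 r)"

text \<open>
  The branching function is \<open>n r = m r - 1\<close> for \<open>r > 0\<close>; written additively, without
  truncated subtraction.
\<close>

definition model_tree :: "'a adjacency \<Rightarrow> 'a \<Rightarrow> (nat \<Rightarrow> nat) \<Rightarrow> bool" where
  "model_tree E x0 n \<longleftrightarrow>
     infinite_tree E \<and>
     (\<exists>m :: nat \<Rightarrow> nat.
        (\<forall>r. \<forall>x \<in> gsphere E x0 r. valence E x = m r) \<and>
        n 0 = m 0 \<and> (\<forall>r>0. n r + 1 = m r))"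

definition laplacian :: "'a adjacency \<Rightarrow> ('a \<Rightarrow> real) \<Rightarrow> 'a \<Rightarrow> real" where
  "laplacian E f x = (\<Sum>y\<in>nbrs E x. f x - f y)"

text \<open>Infinitely differentiable on the closed half-line, with one-sided derivatives at \<open>0\<close>.\<close>

definition smooth_nonneg :: "(real \<Rightarrow> real) \<Rightarrow> bool" where
  "smooth_nonneg f \<longleftrightarrow>
     (\<exists>D :: nat \<Rightarrow> real \<Rightarrow> real. D 0 = f \<and>
        (\<forall>k. \<forall>t\<ge>0. (D k has_real_derivative D (Suc k) t) (at t within {0..})))"

text \<open>
  \<open>p t x y\<close> stands for the heat kernel from \<open>x\<close> to \<open>y\<close> at time \<open>t\<close>; values at \<open>t < 0\<close> are irrelevant throughout. The heat equation
  \<open>\<Delta> p + \<partial>p/\<partial>t = 0\<close> is required in each of the two vertex variables.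
\<close>

definition heat_solution :: "'a adjacency \<Rightarrow> (real \<Rightarrow> 'a \<Rightarrow> 'a \<Rightarrow> real) \<Rightarrow> bool" where
  "heat_solution E p \<longleftrightarrow>
     (\<forall>t\<ge>0. \<forall>x y. 0 \<le> p t x y) \<and>
     (\<forall>x y. smooth_nonneg (\<lambda>t. p t x y)) \<and>
     (\<forall>t\<ge>0. \<forall>x y.
        ((\<lambda>s. p s x y) has_real_derivative - laplacian E (\<lambda>z. p t z y) x) (at t within {0..}) \<and>
        ((\<lambda>s. p s x y) has_real_derivative - laplacian E (\<lambda>z. p t x z) y) (at t within {0..})) \<and>
     (\<forall>x y. p 0 x y = (if x = y then 1 else 0))"

definition heat_kernel :: "'a adjacency \<Rightarrow> (real \<Rightarrow> 'a \<Rightarrow> 'a \<Rightarrow> real) \<Rightarrow> bool" where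
  "heat_kernel E p \<longleftrightarrow>
     heat_solution E p \<and>
     (\<forall>q. heat_solution E q \<longrightarrow> (\<forall>t\<ge>0. \<forall>x y. p t x y \<le> q t x y))"

text \<open>
  The common value at time \<open>t\<close> of the heat kernel \<open>p\<close> of a model tree with root \<open>x0\<close> between
  \<open>x0\<close> and the vertices at distance \<open>r\<close> from it.
\<close>

definition radial_heat_kernel ::
    "'a adjacency \<Rightarrow> 'a \<Rightarrow> (real \<Rightarrow> 'a \<Rightarrow> 'a \<Rightarrow> real) \<Rightarrow> real \<Rightarrow> nat \<Rightarrow> real" where
  "radial_heat_kernel E x0 p t r = (THE v. \<forall>x \<in> gsphere E x0 r. p t x0 x = v)"

end

(* Exhaust the model tree by balls around the root. The Dirichlet heat kernel of a ball, started at
   the root, is radial, and a maximum principle for its successive differences shows that it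
   decreases in the distance r. The radial model Laplacian moves heat outwards at least as fast
   as the Laplacian of T, because T branches less, so transplanting this decreasing function to
   T gives a subsolution of the heat equation on a ball of T; the maximum principle bounds it by
   the heat kernel of T. By minimality, the heat kernel of the model tree is the limit of the
   Dirichlet kernels. *)

theory Submission
  imports Defs
begin

text \<open>The maximum principle is available on finite sets: on an infinite tree a positive
  supremum need not be attained, and bounded solutions with the same initial data may differ. So the
  comparison is made between a Dirichlet kernel, which vanishes outside a finite ball, and a
  nonnegative solution. The heat kernel is characterized by minimality alone, so identifying it with
  the limit of the Dirichlet kernels requires that this limit be smooth and solve the heat equation
  in both variables; this goes through integrated equations and dominated convergence. Monotonicity
  in r is what turns the valence bound into an inequality of Laplacians, since extra branches only
  multiply outward differences. At the root every edge points outwards, so there the condition reads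
  m(x0) \<le> n(0), without the + 1. It is the separate hypothesis \<open>root\<close>: at r = 0
  both kernels start at 1 with time derivatives -n(0) and -m(x0), so the conclusion itself forces
  it.\<close>

section \<open>Maximum principles\<close>

text \<open>After multiplication by exp(-(C + 1) t), a positive maximum over the finite index set
  and [0,T] has a strictly negative time derivative, hence a larger value just before. The
  differential inequality is demanded at indices that are maximal at that time; the term C f leaves
  room for systems with growth.\<close>

lemma finite_max_principle:
  fixes f D :: "'i \<Rightarrow> real \<Rightarrow> real"
  assumes fin: "finite I"
    and deriv: "\<And>i t. i \<in> I \<Longrightarrow> t \<ge> 0 \<Longrightarrow> (f i has_real_derivative D i t) (at t within {0..})"
    and init: "\<And>i. i \<in> I \<Longrightarrow> f i 0 \<le> 0"
    and max: "\<And>i t. i \<in> I \<Longrightarrow> t \<ge> 0 \<Longrightarrow> f i t > 0 \<Longrightarrow> (\<And>j. j \<in> I \<Longrightarrow> f j t \<le> f i t) \<Longrightarrow> D i t \<le> C * f i t"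
    and i: "i \<in> I" and T: "T \<ge> 0"
  shows "f i T \<le> 0"
proof (rule ccontr)
  assume "\<not> f i T \<le> 0"
  \<comment> \<open>With C alone the derivative at the maximum would only be \<le> 0; the extra 1
    makes it strictly negative.\<close>
  define g where "g j t = exp (- (C + 1) * t) * f j t" for j t
  have g_deriv: "(g j has_real_derivative exp (- (C + 1) * t) * (D j t - (C + 1) * f j t)) (at t within {0..})"
    if "j \<in> I" "t \<ge> 0" for j t
    unfolding g_def by (rule derivative_eq_intros deriv that refl | simp add: algebra_simps)+
  have "continuous_on {0..T} (g j)" if "j \<in> I" for j
    using DERIV_continuous_on[OF g_deriv[OF that]] by (auto intro: continuous_on_subset)
  then have "\<exists>s\<in>{0..T}. \<forall>t\<in>{0..T}. g j t \<le> g j s" if "j \<in> I" for j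
    using continuous_attains_sup[of "{0..T}" "g j"] T that by auto
  then obtain s where s: "\<And>j. j \<in> I \<Longrightarrow> s j \<in> {0..T}"
      "\<And>j t. j \<in> I \<Longrightarrow> t \<in> {0..T} \<Longrightarrow> g j t \<le> g j (s j)"
    by metis
  obtain k where k: "k \<in> I" "\<And>j. j \<in> I \<Longrightarrow> g j (s j) \<le> g k (s k)"
    using Max_in[of "(\<lambda>j. g j (s j)) ` I"] Max_ge[of "(\<lambda>j. g j (s j)) ` I"] fin i by fastforce
  have top: "g j t \<le> g k (s k)" if "j \<in> I" "t \<in> {0..T}" for j t
    using s(2)[OF that] k(2)[OF that(1)] by simp
  have "g i T > 0"
    using \<open>\<not> f i T \<le> 0\<close> by (simp add: g_def)
  then have pos: "g k (s k) > 0"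
    using top[OF i, of T] T by simp
  then have fpos: "f k (s k) > 0"
    by (simp add: g_def zero_less_mult_iff)
  have "s k \<noteq> 0"
    using init[OF k(1)] fpos by force
  then have sk: "s k > 0" "s k \<le> T"
    using s(1)[OF k(1)] by auto
  have "f j (s k) \<le> f k (s k)" if "j \<in> I" for j
    using top[OF that, of "s k"] sk by (simp add: g_def)
  then have "D k (s k) \<le> C * f k (s k)"
    using max k(1) sk fpos by auto
  then have "D k (s k) - (C + 1) * f k (s k) < 0"
    using fpos by (simp add: algebra_simps)
  then have neg: "exp (- (C + 1) * s k) * (D k (s k) - (C + 1) * f k (s k)) < 0"
    by (simp add: mult_less_0_iff)
  \<comment> \<open>Looking backwards in time also covers a maximum at T and, for small
    \<open>h\<close>, stays inside [0,T].\<close>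
  obtain d where d: "d > 0" "\<And>h. h > 0 \<Longrightarrow> s k - h \<in> {0..} \<Longrightarrow> h < d \<Longrightarrow> g k (s k) < g k (s k - h)"
    using has_real_derivative_neg_dec_left[OF g_deriv[OF k(1)] neg] sk by auto
  define h where "h = min (d / 2) (s k)"
  have h: "h > 0" "h < d" "s k - h \<in> {0..T}"
    using d(1) sk by (auto simp: h_def)
  then show False
    using d(2)[of h] top[OF k(1) h(3)] by simp
qed

lemma laplacian_at_positive_max:
  assumes "f y > 0" "\<And>z. z \<in> B \<Longrightarrow> f z \<le> f y" "\<And>z. z \<notin> B \<Longrightarrow> f z \<le> 0"
  shows "laplacian E f y \<ge> 0"
  unfolding laplacian_def
proof (rule sum_nonneg)
  fix z show "0 \<le> f y - f z"
    using assms(1) assms(2,3)[of z] by (cases "z \<in> B") auto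
qed

text \<open>Values outside \<open>B\<close> are at most 0, so a positive maximum over
  \<open>B\<close> also dominates all neighbours outside; every summand of the Laplacian is then
  nonnegative and C = 0 suffices.\<close>

lemma dirichlet_max_principle:
  fixes f D :: "real \<Rightarrow> 'a \<Rightarrow> real"
  assumes fin: "finite B"
    and deriv: "\<And>t y. t \<ge> 0 \<Longrightarrow> y \<in> B \<Longrightarrow> ((\<lambda>s. f s y) has_real_derivative D t y) (at t within {0..})"
    and sub: "\<And>t y. t \<ge> 0 \<Longrightarrow> y \<in> B \<Longrightarrow> D t y \<le> - laplacian E (f t) y"
    and out: "\<And>t y. t \<ge> 0 \<Longrightarrow> y \<notin> B \<Longrightarrow> f t y \<le> 0"
    and init: "\<And>y. y \<in> B \<Longrightarrow> f 0 y \<le> 0"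
    and t: "t \<ge> 0"
  shows "f t y \<le> 0"
proof (cases "y \<in> B")
  case True
  show ?thesis
  proof (rule finite_max_principle[where f = "\<lambda>y t. f t y" and D = "\<lambda>y t. D t y" and I = B and C = 0])
    fix y t assume *: "y \<in> B" "t \<ge> 0" "f t y > 0" "\<And>z. z \<in> B \<Longrightarrow> f t z \<le> f t y"
    show "D t y \<le> 0 * f t y"
      using sub[OF *(2,1)] laplacian_at_positive_max[of "f t" y B E, OF *(3,4) out[OF *(2)]] by simp
  qed (use fin deriv init t True in auto)
qed (use out t in auto)

section \<open>Dirichlet heat kernels\<close>

text \<open>On \<open>B\<close> the full valence is kept, so heat crossing the boundary is lost: the
  Dirichlet condition. The zero rows make every image vanish outside \<open>B\<close>.\<close>

definition dirichlet_gen :: "'a adjacency \<Rightarrow> 'a set \<Rightarrow> ('a \<Rightarrow> real) \<Rightarrow> 'a \<Rightarrow> real" where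
  "dirichlet_gen E B f y = (if y \<in> B then - laplacian E f y else 0)"

definition dirichlet_coeff :: "'a adjacency \<Rightarrow> 'a set \<Rightarrow> nat \<Rightarrow> 'a \<Rightarrow> 'a \<Rightarrow> real" where
  "dirichlet_coeff E B k x = (dirichlet_gen E B ^^ k) (\<lambda>y. if x = y \<and> y \<in> B then 1 else 0)"

text \<open>The (x,y) entry of the exponential of t times the generator, written as one scalar power
  series per pair so that termwise differentiation applies.\<close>

definition dirichlet_kernel :: "'a adjacency \<Rightarrow> 'a set \<Rightarrow> real \<Rightarrow> 'a \<Rightarrow> 'a \<Rightarrow> real" where
  "dirichlet_kernel E B t x y = (\<Sum>k. dirichlet_coeff E B k x y / fact k * t ^ k)"

lemma dirichlet_coeff_0: "dirichlet_coeff E B 0 x y = (if x = y \<and> y \<in> B then 1 else 0)"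
  by (simp add: dirichlet_coeff_def)

lemma dirichlet_coeff_Suc: "dirichlet_coeff E B (Suc k) x = dirichlet_gen E B (dirichlet_coeff E B k x)"
  by (simp add: dirichlet_coeff_def)

section \<open>Algebra of the generator in the two vertex variables\<close>

lemma laplacian_diff: "laplacian E (\<lambda>y. f y - g y) y = laplacian E f y - laplacian E g y"
  unfolding laplacian_def sum_subtractf[symmetric] by (intro sum.cong refl) simp

lemma laplacian_minus: "laplacian E (\<lambda>y. - f y) y = - laplacian E f y"
  by (simp add: laplacian_def sum_negf[symmetric])

lemma laplacian_commute:
  "laplacian E (\<lambda>y. laplacian E (\<lambda>x. F x y) x) y = laplacian E (\<lambda>x. laplacian E (F x) y) x"
proof -
  have "laplacian E (\<lambda>y. laplacian E (\<lambda>x. F x y) x) y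
      = (\<Sum>z\<in>nbrs E y. \<Sum>w\<in>nbrs E x. F x y - F w y - (F x z - F w z))"
    unfolding laplacian_def sum_subtractf[symmetric] ..
  also have "\<dots> = (\<Sum>w\<in>nbrs E x. \<Sum>z\<in>nbrs E y. F x y - F x z - (F w y - F w z))"
    by (subst sum.swap) (intro sum.cong refl, simp)
  also have "\<dots> = laplacian E (\<lambda>x. laplacian E (F x) y) x"
    unfolding laplacian_def sum_subtractf[symmetric] ..
  finally show ?thesis .
qed

lemma dirichlet_gen_commute:
  "dirichlet_gen E B (\<lambda>y. dirichlet_gen E B (\<lambda>x. F x y) x) y
     = dirichlet_gen E B (\<lambda>x. dirichlet_gen E B (F x) y) x"
  using laplacian_commute[of E F x y]
  by (cases "x \<in> B"; cases "y \<in> B") (simp_all add: dirichlet_gen_def laplacian_minus, simp_all add: laplacian_def)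

text \<open>The coefficients are built by acting in the second variable, while a heat solution must
  satisfy the equation in both. Generators in different variables commute, which carries the
  induction; symmetry of \<open>E\<close> enters at k = 0.\<close>

lemma dirichlet_coeff_Suc_left:
  assumes "symp E" and fin: "\<And>x. finite (nbrs E x)"
  shows "dirichlet_coeff E B (Suc k) x y = dirichlet_gen E B (\<lambda>w. dirichlet_coeff E B k w y) x"
proof (induction k arbitrary: x y)
  case 0
  have sym: "E y x \<longleftrightarrow> E x y"
    using assms(1) by (auto dest: sympD)
  \<comment> \<open>Off the diagonal both sides are the indicator of the edge between
    \<open>x\<close> and \<open>y\<close>, counted once among the neighbours of \<open>y\<close> and
    once among those of \<open>x\<close>.\<close>
  have 1: "(\<Sum>z\<in>nbrs E y. if x = z then 1 else 0::real) = (if E x y then 1 else 0)"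
    using fin[of y] sym by (simp add: nbrs_def)
  have 2: "(\<Sum>z\<in>nbrs E x. if z = y then 1 else 0::real) = (if E x y then 1 else 0)"
    using fin[of x] by (simp add: nbrs_def)
  have 3: "(\<Sum>z\<in>nbrs E y. if x = z \<and> z \<in> B then 1 else 0::real) = (if E x y then 1 else 0)" if "x \<in> B"
    using that by (subst 1[symmetric]) (auto intro!: sum.cong)
  have 4: "(\<Sum>z\<in>nbrs E y. if x = z \<and> z \<in> B then 1 else 0::real) = 0" if "x \<notin> B"
    using that by (auto intro!: sum.neutral)
  show ?case
    unfolding dirichlet_coeff_Suc dirichlet_gen_def laplacian_def dirichlet_coeff_0
    using 2 3 4 by (auto simp: sum_subtractf)
next
  case (Suc k)
  have "dirichlet_coeff E B (Suc (Suc k)) x y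
      = dirichlet_gen E B (\<lambda>y. dirichlet_gen E B (\<lambda>w. dirichlet_coeff E B k w y) x) y"
    unfolding dirichlet_coeff_Suc[of E B "Suc k"] using Suc[of x] by presburger
  also have "\<dots> = dirichlet_gen E B (\<lambda>w. dirichlet_gen E B (dirichlet_coeff E B k w) y) x"
    by (rule dirichlet_gen_commute)
  finally show ?case
    unfolding dirichlet_coeff_Suc .
qed

text \<open>2M bounds the generator in the supremum norm: at most M neighbours, each difference at
  most twice the supremum.\<close>

lemma dirichlet_coeff_bound:
  assumes M: "\<And>y. y \<in> B \<Longrightarrow> real (valence E y) \<le> M" and "M \<ge> 0"
  shows "\<bar>dirichlet_coeff E B k x y\<bar> \<le> (2 * M) ^ k"
proof (induction k arbitrary: y)
  case (Suc k)
  show ?case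
  proof (cases "y \<in> B")
    case True
    have "\<bar>laplacian E (dirichlet_coeff E B k x) y\<bar>
        \<le> (\<Sum>z\<in>nbrs E y. \<bar>dirichlet_coeff E B k x y - dirichlet_coeff E B k x z\<bar>)"
      unfolding laplacian_def by (rule sum_abs)
    also have "\<dots> \<le> (\<Sum>z\<in>nbrs E y. 2 * (2 * M) ^ k)"
    proof (rule sum_mono)
      fix z show "\<bar>dirichlet_coeff E B k x y - dirichlet_coeff E B k x z\<bar> \<le> 2 * (2 * M) ^ k"
        using Suc[of y] Suc[of z] by linarith
    qed
    also have "\<dots> = valence E y * (2 * (2 * M) ^ k)"
      by (simp add: valence_def)
    also have "\<dots> \<le> M * (2 * (2 * M) ^ k)"
      using M[OF True] \<open>M \<ge> 0\<close> by (intro mult_right_mono) auto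
    finally show ?thesis
      using True by (simp add: dirichlet_coeff_Suc dirichlet_gen_def mult_ac)
  qed (use \<open>M \<ge> 0\<close> in \<open>simp add: dirichlet_coeff_Suc dirichlet_gen_def\<close>)
qed (simp add: dirichlet_coeff_0)

lemma dirichlet_series_summable:
  assumes "finite B"
  shows "summable (\<lambda>k. dirichlet_coeff E B k x y / fact k * t ^ k)"
proof -
  \<comment> \<open>A crude common bound for the valences on \<open>B\<close>; as a sum it also
    makes sense for empty \<open>B\<close>.\<close>
  define M where "M = real (\<Sum>y\<in>B. valence E y)"
  have M: "real (valence E y) \<le> M" if "y \<in> B" for y
    unfolding M_def of_nat_le_iff using assms that by (intro member_le_sum) auto
  have "M \<ge> 0"
    unfolding M_def by (rule of_nat_0_le_iff)
  have "summable (\<lambda>k. (2 * M * \<bar>t\<bar>) ^ k /\<^sub>R fact k)"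
    using exp_converges sums_summable by blast
  moreover have "norm (dirichlet_coeff E B k x y / fact k * t ^ k) \<le> (2 * M * \<bar>t\<bar>) ^ k /\<^sub>R fact k" for k
  proof -
    have "\<bar>dirichlet_coeff E B k x y\<bar> * \<bar>t\<bar> ^ k / fact k \<le> (2 * M) ^ k * \<bar>t\<bar> ^ k / fact k"
      using dirichlet_coeff_bound[OF M \<open>M \<ge> 0\<close>] by (intro divide_right_mono mult_right_mono) auto
    then show ?thesis
      by (simp add: abs_mult power_abs power_mult_distrib divide_inverse mult_ac)
  qed
  ultimately show ?thesis
    by (rule summable_comparison_test'[where N = 0])
qed

lemma dirichlet_kernel_sums:
  assumes "finite B"
  shows "(\<lambda>k. dirichlet_coeff E B k x y / fact k * t ^ k) sums dirichlet_kernel E B t x y"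
  unfolding dirichlet_kernel_def using dirichlet_series_summable[OF assms] by (rule summable_sums)

lemma dirichlet_gen_sums:
  assumes "\<And>y. (\<lambda>k. c k y) sums f y"
  shows "(\<lambda>k. dirichlet_gen E B (c k) y) sums dirichlet_gen E B f y"
proof (cases "y \<in> B")
  case True
  have "(\<lambda>k. - (\<Sum>z\<in>nbrs E y. c k y - c k z)) sums (- (\<Sum>z\<in>nbrs E y. f y - f z))"
    by (intro sums_minus sums_sum sums_diff assms)
  then show ?thesis
    using True by (simp add: dirichlet_gen_def laplacian_def)
qed (simp add: dirichlet_gen_def)

lemma dirichlet_gen_scale: "dirichlet_gen E B (\<lambda>y. f y * a) y = dirichlet_gen E B f y * a"
  by (simp add: dirichlet_gen_def laplacian_def sum_distrib_right left_diff_distrib)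

text \<open>The factorials turn differentiation into an index shift. The resulting series is then
  read as the generator acting in either variable.\<close>

lemma dirichlet_kernel_deriv_series:
  assumes "finite B"
  shows "((\<lambda>t. dirichlet_kernel E B t x y) has_real_derivative
           (\<Sum>k. dirichlet_coeff E B (Suc k) x y / fact k * t ^ k)) (at t)"
proof -
  have "diffs (\<lambda>k. dirichlet_coeff E B k x y / fact k) = (\<lambda>k. dirichlet_coeff E B (Suc k) x y / fact k)"
    by (rule ext) (simp add: diffs_def del: of_nat_Suc)
  then show ?thesis
    using termdiffs_strong_converges_everywhere[of "\<lambda>k. dirichlet_coeff E B k x y / fact k" t]
      dirichlet_series_summable[OF assms, of E x y]
    unfolding dirichlet_kernel_def by simp
qed

lemma dirichlet_kernel_deriv:
  assumes "finite B"
  shows "((\<lambda>t. dirichlet_kernel E B t x y) has_real_derivative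
           dirichlet_gen E B (dirichlet_kernel E B t x) y) (at t)"
proof -
  have "(\<lambda>k. dirichlet_gen E B (\<lambda>y. dirichlet_coeff E B k x y / fact k * t ^ k) y)
          sums dirichlet_gen E B (dirichlet_kernel E B t x) y"
    by (rule dirichlet_gen_sums) (rule dirichlet_kernel_sums[OF assms])
  moreover have "dirichlet_gen E B (\<lambda>y. dirichlet_coeff E B k x y / fact k * t ^ k) y
      = dirichlet_coeff E B (Suc k) x y / fact k * t ^ k" for k
    using dirichlet_gen_scale[of E B "dirichlet_coeff E B k x" "t ^ k / fact k" y]
    by (simp add: dirichlet_coeff_Suc)
  ultimately show ?thesis
    using dirichlet_kernel_deriv_series[OF assms, of E x y t] by (simp add: sums_iff)
qed

lemma dirichlet_kernel_deriv_left:
  assumes "finite B" "symp E" "\<And>x. finite (nbrs E x)"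
  shows "((\<lambda>t. dirichlet_kernel E B t x y) has_real_derivative
           dirichlet_gen E B (\<lambda>w. dirichlet_kernel E B t w y) x) (at t)"
proof -
  have "(\<lambda>k. dirichlet_gen E B (\<lambda>w. dirichlet_coeff E B k w y / fact k * t ^ k) x)
          sums dirichlet_gen E B (\<lambda>w. dirichlet_kernel E B t w y) x"
    by (rule dirichlet_gen_sums) (rule dirichlet_kernel_sums[OF assms(1)])
  moreover have "dirichlet_gen E B (\<lambda>w. dirichlet_coeff E B k w y / fact k * t ^ k) x
      = dirichlet_coeff E B (Suc k) x y / fact k * t ^ k" for k
    using dirichlet_gen_scale[of E B "\<lambda>w. dirichlet_coeff E B k w y" "t ^ k / fact k" x]
    by (simp add: dirichlet_coeff_Suc_left[OF assms(2,3)])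
  ultimately show ?thesis
    using dirichlet_kernel_deriv_series[OF assms(1), of E x y t] by (simp add: sums_iff)
qed

lemma dirichlet_kernel_0: "dirichlet_kernel E B 0 x y = (if x = y \<and> y \<in> B then 1 else 0)"
  unfolding dirichlet_kernel_def by (subst powser_zero) (simp add: dirichlet_coeff_0)

lemma dirichlet_kernel_outside:
  assumes "y \<notin> B"
  shows "dirichlet_kernel E B t x y = 0"
proof -
  have "dirichlet_coeff E B k x y = 0" for k
    using assms by (cases k) (auto simp: dirichlet_coeff_0 dirichlet_coeff_Suc dirichlet_gen_def)
  then show ?thesis
    by (simp add: dirichlet_kernel_def)
qed

lemma dirichlet_kernel_heat:
  assumes "finite B" "y \<in> B"
  shows "((\<lambda>t. dirichlet_kernel E B t x y) has_real_derivative
           - laplacian E (dirichlet_kernel E B t x) y) (at t within S)"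
  using has_field_derivative_at_within[OF dirichlet_kernel_deriv[OF assms(1), of E x y t]] assms(2)
  by (simp add: dirichlet_gen_def)

lemma dirichlet_kernel_heat_left:
  assumes "finite B" "symp E" "\<And>x. finite (nbrs E x)" "x \<in> B"
  shows "((\<lambda>t. dirichlet_kernel E B t x y) has_real_derivative
           - laplacian E (\<lambda>w. dirichlet_kernel E B t w y) x) (at t within S)"
  using has_field_derivative_at_within[OF dirichlet_kernel_deriv_left[OF assms(1-3), of x y t]] assms(4)
  by (simp add: dirichlet_gen_def)

section \<open>Positivity and comparison for Dirichlet kernels\<close>

lemma dirichlet_kernel_nonneg:
  assumes fin: "finite B" and "t \<ge> 0"
  shows "dirichlet_kernel E B t x y \<ge> 0"
proof -
  have "- dirichlet_kernel E B t x y \<le> 0"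
  proof (rule dirichlet_max_principle[where E = E and f = "\<lambda>t y. - dirichlet_kernel E B t x y"
        and D = "\<lambda>t y. - (- laplacian E (dirichlet_kernel E B t x) y)"])
    fix t :: real and y assume "y \<in> B"
    show "((\<lambda>s. - dirichlet_kernel E B s x y) has_real_derivative
        - (- laplacian E (dirichlet_kernel E B t x) y)) (at t within {0..})"
      by (rule DERIV_minus) (rule dirichlet_kernel_heat[OF fin \<open>y \<in> B\<close>])
    show "- (- laplacian E (dirichlet_kernel E B t x) y) \<le> - laplacian E (\<lambda>y. - dirichlet_kernel E B t x y) y"
      by (simp add: laplacian_minus)
  qed (use assms in \<open>auto simp: dirichlet_kernel_0 dirichlet_kernel_outside\<close>)
  then show ?thesis by simp
qed

text \<open>The difference solves the heat equation inside \<open>B\<close> and is at most 0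
  outside, where the kernel vanishes. With \<open>g\<close> the kernel of a larger set this gives
  monotonicity in the set; with \<open>g\<close> a heat solution it gives a bound independent of the
  set.\<close>

lemma dirichlet_kernel_le:
  assumes fin: "finite B"
    and deriv: "\<And>t y. t \<ge> 0 \<Longrightarrow> y \<in> B \<Longrightarrow>
      ((\<lambda>s. g s y) has_real_derivative - laplacian E (g t) y) (at t within {0..})"
    and nonneg: "\<And>t y. t \<ge> 0 \<Longrightarrow> g t y \<ge> 0"
    and init: "\<And>y. y \<in> B \<Longrightarrow> g 0 y \<ge> (if x = y then 1 else 0)"
    and "t \<ge> 0"
  shows "dirichlet_kernel E B t x y \<le> g t y"
proof -
  have "dirichlet_kernel E B t x y - g t y \<le> 0"
  proof (rule dirichlet_max_principle[where E = E and f = "\<lambda>t y. dirichlet_kernel E B t x y - g t y"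
        and D = "\<lambda>t y. - laplacian E (dirichlet_kernel E B t x) y - - laplacian E (g t) y"])
    fix t :: real and y assume *: "t \<ge> 0" "y \<in> B"
    show "((\<lambda>s. dirichlet_kernel E B s x y - g s y) has_real_derivative
        - laplacian E (dirichlet_kernel E B t x) y - - laplacian E (g t) y) (at t within {0..})"
      by (rule DERIV_diff[OF dirichlet_kernel_heat[OF fin *(2)] deriv[OF *]])
    show "- laplacian E (dirichlet_kernel E B t x) y - - laplacian E (g t) y
        \<le> - laplacian E (\<lambda>y. dirichlet_kernel E B t x y - g t y) y"
      by (simp add: laplacian_diff)
  next
    fix y assume "y \<in> B"
    then show "dirichlet_kernel E B 0 x y - g 0 y \<le> 0"
      using init[of y] by (simp add: dirichlet_kernel_0)
  next
    fix t :: real and y assume "t \<ge> 0" "y \<notin> B"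
    then show "dirichlet_kernel E B t x y - g t y \<le> 0"
      using nonneg[of t y] by (simp add: dirichlet_kernel_outside)
  qed (use fin \<open>t \<ge> 0\<close> in auto)
  then show ?thesis by simp
qed

lemma dirichlet_kernel_mono:
  assumes "finite B'" "B \<subseteq> B'" "t \<ge> 0"
  shows "dirichlet_kernel E B t x y \<le> dirichlet_kernel E B' t x y"
proof (rule dirichlet_kernel_le)
  show "finite B"
    using assms finite_subset by blast
  fix y assume "y \<in> B"
  then show "dirichlet_kernel E B' 0 x y \<ge> (if x = y then 1 else 0)"
    using assms(2) by (auto simp: dirichlet_kernel_0)
next
  fix t :: real and y assume "y \<in> B"
  then show "((\<lambda>s. dirichlet_kernel E B' s x y) has_real_derivative
      - laplacian E (dirichlet_kernel E B' t x) y) (at t within {0..})"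
    using dirichlet_kernel_heat[OF assms(1)] assms(2) by blast
qed (use assms dirichlet_kernel_nonneg in auto)

lemma dirichlet_kernel_le_heat_solution:
  assumes "finite B" "heat_solution E p" "t \<ge> 0"
  shows "dirichlet_kernel E B t x y \<le> p t x y"
proof (rule dirichlet_kernel_le)
  fix t :: real and y assume "t \<ge> 0"
  then show "((\<lambda>s. p s x y) has_real_derivative - laplacian E (p t x) y) (at t within {0..})" "p t x y \<ge> 0"
    using assms(2) unfolding heat_solution_def by blast+
next
  fix y
  have "p 0 x y = (if x = y then 1 else 0)"
    using assms(2) unfolding heat_solution_def by blast
  then show "(if x = y then 1 else 0) \<le> p 0 x y"
    by simp
qed (use assms in simp_all)

section \<open>Exhaustion\<close>

text \<open>Derivatives do not pass to pointwise limits, but the integrated equation does: pointwise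
  convergence and a continuous majorant are enough for dominated convergence.\<close>

lemma dominated_limit_integral:
  fixes F G :: "nat \<Rightarrow> real \<Rightarrow> real"
  assumes deriv: "\<And>k t. t \<ge> 0 \<Longrightarrow> (F k has_real_derivative G k t) (at t within {0..})"
    and F_lim: "\<And>t. t \<ge> 0 \<Longrightarrow> (\<lambda>k. F k t) \<longlonglongrightarrow> F' t"
    and G_lim: "\<And>t. t \<ge> 0 \<Longrightarrow> (\<lambda>k. G k t) \<longlonglongrightarrow> G' t"
    and bound: "\<And>k t. t \<ge> 0 \<Longrightarrow> \<bar>G k t\<bar> \<le> H t"
    and H: "continuous_on {0..} H"
    and T: "T \<ge> 0"
  shows "G' integrable_on {0..T}" "F' T = F' 0 + integral {0..T} G'"
proof -
  have int: "(G k has_integral F k T - F k 0) {0..T}" for k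
    by (rule fundamental_theorem_of_calculus[OF T])
      (auto simp: has_real_derivative_iff_has_vector_derivative[symmetric]
        intro!: has_field_derivative_subset[OF deriv])
  have H': "H integrable_on {0..T}"
    using continuous_on_subset[OF H] by (intro integrable_continuous_real) auto
  note dom = dominated_convergence[of G "{0..T}" H G']
  show "G' integrable_on {0..T}"
    using int H' bound G_lim by (intro dom(1)) (auto intro: has_integral_integrable)
  have "(\<lambda>k. integral {0..T} (G k)) \<longlonglongrightarrow> integral {0..T} G'"
    using int H' bound G_lim by (intro dom(2)) (auto intro: has_integral_integrable)
  moreover have "integral {0..T} (G k) = F k T - F k 0" for k
    using int by (rule integral_unique)
  ultimately have "(\<lambda>k. F k T - F k 0) \<longlonglongrightarrow> integral {0..T} G'"
    by simp
  moreover have "(\<lambda>k. F k T - F k 0) \<longlonglongrightarrow> F' T - F' 0"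
    using F_lim T by (intro tendsto_diff) auto
  ultimately have "integral {0..T} G' = F' T - F' 0"
    by (rule LIMSEQ_unique)
  then show "F' T = F' 0 + integral {0..T} G'"
    by simp
qed

text \<open>Facts about integrals live on compact intervals; the right end t + 1 keeps
  \<open>t\<close> away from it, so the one-sided filter on the half-line is unchanged.\<close>

lemma at_within_nonneg_eq:
  fixes t :: real
  assumes "t \<ge> 0"
  shows "at t within {0..t + 1} = at t within {0..}"
  by (rule at_within_nhd[where S = "{..<t + 1}"]) auto

lemma integral_equation_continuous:
  fixes f g :: "real \<Rightarrow> real"
  assumes "\<And>T. T \<ge> 0 \<Longrightarrow> g integrable_on {0..T}" "\<And>T. T \<ge> 0 \<Longrightarrow> f T = f 0 + integral {0..T} g"
  shows "continuous_on {0..} f"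
  unfolding continuous_on_eq_continuous_within
proof
  fix t :: real assume "t \<in> {0..}"
  then have t: "t \<ge> 0" by simp
  have "continuous_on {0..t + 1} (\<lambda>T. f 0 + integral {0..T} g)"
    using assms(1)[of "t + 1"] t by (intro continuous_intros indefinite_integral_continuous_1) auto
  then have "continuous_on {0..t + 1} f"
    by (rule continuous_on_eq) (simp add: assms(2)[symmetric])
  then have "continuous (at t within {0..t + 1}) f"
    using t by (auto simp: continuous_on_eq_continuous_within)
  then show "continuous (at t within {0..}) f"
    by (simp add: at_within_nonneg_eq[OF t])
qed

lemma integral_equation_deriv:
  fixes f g :: "real \<Rightarrow> real"
  assumes "continuous_on {0..} g" "\<And>T. T \<ge> 0 \<Longrightarrow> f T = f 0 + integral {0..T} g" and t: "t \<ge> 0"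
  shows "(f has_real_derivative g t) (at t within {0..})"
proof -
  have "continuous_on {0..t + 1} g"
    using assms(1) by (rule continuous_on_subset) auto
  then have "((\<lambda>T. f 0 + integral {0..T} g) has_real_derivative 0 + g t) (at t within {0..t + 1})"
    using t by (intro DERIV_add DERIV_const integral_has_real_derivative) auto
  then have "(f has_real_derivative 0 + g t) (at t within {0..t + 1})"
    by (rule has_field_derivative_transform_within[where d = 1]) (use t in \<open>simp_all add: assms(2)[symmetric]\<close>)
  then show ?thesis
    by (simp add: at_within_nonneg_eq[OF t])
qed

lemma laplacian_has_deriv:
  assumes "\<And>y. ((\<lambda>s. f s y) has_real_derivative D y) (at t within S)"
  shows "((\<lambda>s. - laplacian E (f s) y) has_real_derivative - laplacian E D y) (at t within S)"
  unfolding laplacian_def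
  by (rule DERIV_minus, rule DERIV_sum[where f' = "\<lambda>z. D y - D z"], rule DERIV_diff; rule assms)

text \<open>The equation holds at every vertex and the Laplacian commutes with the time derivative,
  so the k-th time derivative is the k-th power of -\<Delta>.\<close>

lemma heat_flow_smooth:
  assumes "\<And>t y. t \<ge> 0 \<Longrightarrow> ((\<lambda>s. f s y) has_real_derivative - laplacian E (f t) y) (at t within {0..})"
  shows "smooth_nonneg (\<lambda>t. f t y)"
proof -
  define L where "L g y = - laplacian E g y" for g :: "'a \<Rightarrow> real" and y
  have "((\<lambda>s. (L ^^ k) (f s) y) has_real_derivative (L ^^ Suc k) (f t) y) (at t within {0..})"
    if "t \<ge> 0" for k t y
  proof (induction k arbitrary: y)
    case (Suc k)
    show ?case
      using laplacian_has_deriv[OF Suc, of E] by (simp add: L_def)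
  qed (use assms[OF that] in \<open>simp add: L_def\<close>)
  then show ?thesis
    unfolding smooth_nonneg_def by (intro exI[of _ "\<lambda>k t. (L ^^ k) (f t) y"]) auto
qed

text \<open>Minimality enters here: the increasing limit of the Dirichlet kernels is itself a heat
  solution, so it dominates the heat kernel, and the maximum principle gives the converse.\<close>

lemma heat_kernel_exhaustion:
  fixes p :: "real \<Rightarrow> 'a \<Rightarrow> 'a \<Rightarrow> real"
  assumes kernel: "heat_kernel E p" and sym: "symp E" and nbrs: "\<And>x. finite (nbrs E x)"
    and fin: "\<And>k. finite (B k)" and inc: "incseq B" and cover: "(\<Union>k. B k) = UNIV"
    and t: "t \<ge> 0"
  shows "(\<lambda>k. dirichlet_kernel E (B k) t x y) \<longlonglongrightarrow> p t x y"
proof -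
  have sol: "heat_solution E p"
    using kernel by (simp add: heat_kernel_def)
  define K where "K k t x y = dirichlet_kernel E (B k) t x y" for k t x y
  define q where "q t x y = lim (\<lambda>k. K k t x y)" for t x y
  have K_le: "K k t x y \<le> p t x y" and K_nonneg: "0 \<le> K k t x y" if "t \<ge> 0" for k t x y
    using dirichlet_kernel_le_heat_solution[OF fin sol that] dirichlet_kernel_nonneg[OF fin that]
    by (auto simp: K_def)
  have K_lim: "(\<lambda>k. K k t x y) \<longlonglongrightarrow> q t x y" if "t \<ge> 0" for t x y
  proof -
    have "incseq (\<lambda>k. K k t x y)"
      unfolding K_def using dirichlet_kernel_mono[OF fin incseqD[OF inc] that] by (auto intro: incseq_SucI)
    moreover have "\<forall>k. K k t x y \<le> p t x y"
      using K_le[OF that] by simp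
    ultimately obtain l where "(\<lambda>k. K k t x y) \<longlonglongrightarrow> l"
      by (rule incseq_convergent)
    then show ?thesis
      unfolding q_def by (simp add: limI)
  qed
  \<comment> \<open>\<open>p\<close> lies above every \<open>K k\<close>, so its continuity in time
    supplies a majorant of the Laplacians of \<open>K k\<close> that is continuous and independent
    of \<open>k\<close>.\<close>
  have p_cont: "continuous_on {0..} (\<lambda>t. p t x y)" for x y
  proof (rule DERIV_continuous_on)
    fix t :: real assume "t \<in> {0..}"
    then show "((\<lambda>s. p s x y) has_real_derivative - laplacian E (p t x) y) (at t within {0..})"
      using sol unfolding heat_solution_def by (metis atLeast_iff)
  qed
  \<comment> \<open>A Dirichlet kernel solves the heat equation only inside its own set; dropping
    the first \<open>N\<close> terms leaves the sets containing \<open>y\<close>.\<close>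
  have large: "\<exists>N. \<forall>k. y \<in> B (k + N)" for y
  proof -
    obtain N where "y \<in> B N"
      using cover by blast
    then have "y \<in> B (k + N)" for k
      using incseqD[OF inc, of N "k + N"] by auto
    then show ?thesis by blast
  qed
  have lap_bound: "\<bar>- laplacian E f y\<bar> \<le> (\<Sum>z\<in>nbrs E y. g y + g z)"
    if "\<And>z. 0 \<le> f z" "\<And>z. f z \<le> g z" for f g :: "'a \<Rightarrow> real" and y
  proof -
    have "\<bar>f y - f z\<bar> \<le> g y + g z" for z
      using that(1)[of y] that(1)[of z] that(2)[of y] that(2)[of z] by linarith
    then show ?thesis
      unfolding laplacian_def abs_minus_cancel by (intro order_trans[OF sum_abs] sum_mono)
  qed
  have lap_lim: "(\<lambda>k. - laplacian E (f k) y) \<longlonglongrightarrow> - laplacian E g y"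
    if "\<And>z. (\<lambda>k. f k z) \<longlonglongrightarrow> g z" for f g and y :: 'a
    unfolding laplacian_def by (intro tendsto_intros that)
  have right: "(\<lambda>t. - laplacian E (q t x) y) integrable_on {0..T}"
    "q T x y = q 0 x y + integral {0..T} (\<lambda>t. - laplacian E (q t x) y)" if "T \<ge> 0" for T x y
  proof -
    obtain N where N: "\<And>k. y \<in> B (k + N)"
      using large by blast
    have d: "((\<lambda>t. K (k + N) t x y) has_real_derivative - laplacian E (K (k + N) t x) y) (at t within {0..})" for k t
      unfolding K_def by (rule dirichlet_kernel_heat[OF fin N])
    have "(\<lambda>k. - laplacian E (K (k + N) t x) y) \<longlonglongrightarrow> - laplacian E (q t x) y" if "t \<ge> 0" for t
      by (intro lap_lim LIMSEQ_ignore_initial_segment K_lim that)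
    note * = dominated_limit_integral[where F = "\<lambda>k t. K (k + N) t x y" and F' = "\<lambda>t. q t x y",
        OF d LIMSEQ_ignore_initial_segment[OF K_lim] this
        lap_bound[OF K_nonneg K_le] continuous_on_sum[OF continuous_on_add[OF p_cont p_cont]] \<open>T \<ge> 0\<close>]
    show "(\<lambda>t. - laplacian E (q t x) y) integrable_on {0..T}"
      "q T x y = q 0 x y + integral {0..T} (\<lambda>t. - laplacian E (q t x) y)"
      by (rule *; simp)+
  qed
  have left: "q T x y = q 0 x y + integral {0..T} (\<lambda>t. - laplacian E (\<lambda>w. q t w y) x)" if "T \<ge> 0" for T x y
  proof -
    obtain N where N: "\<And>k. x \<in> B (k + N)"
      using large by blast
    have d: "((\<lambda>t. K (k + N) t x y) has_real_derivative - laplacian E (\<lambda>w. K (k + N) t w y) x) (at t within {0..})" for k t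
      unfolding K_def by (rule dirichlet_kernel_heat_left[OF fin sym nbrs N])
    have "(\<lambda>k. - laplacian E (\<lambda>w. K (k + N) t w y) x) \<longlonglongrightarrow> - laplacian E (\<lambda>w. q t w y) x" if "t \<ge> 0" for t
      by (intro lap_lim LIMSEQ_ignore_initial_segment K_lim that)
    note * = dominated_limit_integral(2)[where F = "\<lambda>k t. K (k + N) t x y" and F' = "\<lambda>t. q t x y",
        OF d LIMSEQ_ignore_initial_segment[OF K_lim] this
        lap_bound[OF K_nonneg K_le] continuous_on_sum[OF continuous_on_add[OF p_cont p_cont]] \<open>T \<ge> 0\<close>]
    show ?thesis
      by (rule *; simp)
  qed
  \<comment> \<open>Bootstrap: the integral equation makes \<open>q\<close> continuous, hence also
    the integrand, a finite combination of values of \<open>q\<close>; then the integral can be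
    differentiated.\<close>
  have q_cont: "continuous_on {0..} (\<lambda>t. q t x y)" for x y
    using right by (rule integral_equation_continuous)
  have right_deriv: "((\<lambda>s. q s x y) has_real_derivative - laplacian E (q t x) y) (at t within {0..})"
    if "t \<ge> 0" for t x y
    by (rule integral_equation_deriv[OF _ right(2) that])
      (auto simp: laplacian_def intro!: continuous_intros q_cont)
  have left_deriv: "((\<lambda>s. q s x y) has_real_derivative - laplacian E (\<lambda>w. q t w y) x) (at t within {0..})"
    if "t \<ge> 0" for t x y
    by (rule integral_equation_deriv[OF _ left that])
      (auto simp: laplacian_def intro!: continuous_intros q_cont)
  have "q 0 x y = (if x = y then 1 else 0)" for x y
  proof -
    obtain N where N: "\<And>k. y \<in> B (k + N)"
      using large by blast
    have "(\<lambda>k. K (k + N) 0 x y) \<longlonglongrightarrow> (if x = y then 1 else 0)"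
      using N by (simp add: K_def dirichlet_kernel_0)
    moreover have "(\<lambda>k. K (k + N) 0 x y) \<longlonglongrightarrow> q 0 x y"
      by (rule LIMSEQ_ignore_initial_segment) (simp add: K_lim)
    ultimately show ?thesis
      by (rule LIMSEQ_unique[symmetric])
  qed
  moreover have "0 \<le> q t x y" if "t \<ge> 0" for t x y
    by (rule LIMSEQ_le_const[OF K_lim[OF that]]) (auto intro: K_nonneg that)
  ultimately have "heat_solution E q"
    unfolding heat_solution_def using right_deriv left_deriv heat_flow_smooth[OF right_deriv] by simp
  then have "p t x y \<le> q t x y"
    using kernel t unfolding heat_kernel_def by blast
  moreover have "q t x y \<le> p t x y"
    by (rule LIMSEQ_le_const2[OF K_lim[OF t]]) (auto intro: K_le t)
  ultimately show ?thesis
    using K_lim[OF t, of x y] by (simp add: K_def)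
qed

section \<open>Distance to the root of a tree\<close>

abbreviation gball :: "'a adjacency \<Rightarrow> 'a \<Rightarrow> nat \<Rightarrow> 'a set" where
  "gball E x0 r \<equiv> {x. graph_dist E x x0 \<le> r}"

lemma infinite_graph_sym:
  assumes "infinite_graph E" "E x y"
  shows "E y x"
proof -
  have "symp E"
    using assms(1) by (simp add: infinite_graph_def)
  then show ?thesis
    using assms(2) unfolding symp_def by blast
qed

lemma infinite_graph_irrefl:
  assumes "infinite_graph E" "E x y"
  shows "x \<noteq> y"
proof -
  have "irreflp E"
    using assms(1) by (simp add: infinite_graph_def)
  then show ?thesis
    using assms(2) unfolding irreflp_def by blast
qed

lemma graph_dist_le: "(E ^^ k) x y \<Longrightarrow> graph_dist E x y \<le> k"
  unfolding graph_dist_def by (rule Least_le)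

lemma graph_dist_walk:
  assumes "infinite_graph E"
  shows "(E ^^ graph_dist E x y) x y"
proof -
  have "\<exists>k. (E ^^ k) x y"
    using assms rtranclp_imp_relpowp unfolding infinite_graph_def by metis
  then show ?thesis
    unfolding graph_dist_def by (rule LeastI_ex)
qed

lemma graph_dist_eq_0:
  assumes "infinite_graph E"
  shows "graph_dist E x y = 0 \<longleftrightarrow> x = y"
proof
  assume "graph_dist E x y = 0"
  then show "x = y"
    using graph_dist_walk[OF assms, of x y] by simp
next
  assume "x = y"
  then show "graph_dist E x y = 0"
    using graph_dist_le[of 0 E x y] by simp
qed

lemma graph_dist_nbr:
  assumes "infinite_graph E" "E x y"
  shows "graph_dist E x z \<le> Suc (graph_dist E y z)"
  by (rule graph_dist_le, rule relpowp_Suc_I2[of E, OF assms(2)], rule graph_dist_walk[OF assms(1)])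

lemma graph_dist_pred:
  assumes "infinite_graph E" "graph_dist E x z = Suc r"
  obtains y where "E x y" "graph_dist E y z = r"
proof -
  obtain y where y: "E x y" "(E ^^ r) y z"
    using graph_dist_walk[OF assms(1), of x z] assms(2) relpowp_Suc_D2[of r E x z] by auto
  then show ?thesis
    using that[of y] graph_dist_le[OF y(2)] graph_dist_nbr[OF assms(1) y(1), of z] assms(2) by simp
qed

lemma finite_gball:
  assumes E: "infinite_graph E"
  shows "finite (gball E x0 r)"
proof (induction r)
  case 0
  then show ?case
    by (simp add: graph_dist_eq_0[OF E])
next
  case (Suc r)
  have "gball E x0 (Suc r) \<subseteq> gball E x0 r \<union> (\<Union>y\<in>gball E x0 r. nbrs E y)"
  proof
    fix x assume x: "x \<in> gball E x0 (Suc r)"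
    show "x \<in> gball E x0 r \<union> (\<Union>y\<in>gball E x0 r. nbrs E y)"
    proof (cases "graph_dist E x x0 = Suc r")
      case True
      then obtain y where "E x y" "graph_dist E y x0 = r"
        using graph_dist_pred[OF E] by blast
      then show ?thesis
        using infinite_graph_sym[OF E] by (auto simp: nbrs_def)
    qed (use x in auto)
  qed
  moreover have "finite (\<Union>y\<in>gball E x0 r. nbrs E y)"
    using Suc E by (auto simp: infinite_graph_def)
  ultimately show ?case
    using Suc finite_subset by blast
qed

text \<open>By \<open>graph_dist_pred\<close> an empty sphere forces all larger ones to be empty,
  and the graph would be a finite ball.\<close>

lemma gsphere_nonempty:
  fixes E :: "'a adjacency"
  assumes E: "infinite_graph E"
  shows "\<exists>x. graph_dist E x x0 = r"
proof (rule ccontr)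
  assume empty: "\<nexists>x. graph_dist E x x0 = r"
  have "graph_dist E x x0 \<noteq> r + k" for x k
  proof (induction k arbitrary: x)
    case (Suc k)
    then show ?case
      using graph_dist_pred[OF E, of x x0 "r + k"] by (metis add_Suc_right)
  qed (use empty in auto)
  then have "graph_dist E x x0 \<le> r" for x
    by (metis le_add_diff_inverse nat_le_linear)
  then have "(UNIV :: 'a set) = gball E x0 r"
    by auto
  then show False
    using finite_gball[OF E, of x0 r] E by (simp add: infinite_graph_def)
qed

lemma valence_le_max_valence:
  assumes "infinite_graph E"
  shows "valence E x \<le> max_valence E x0 (graph_dist E x x0)"
proof -
  have "finite (gsphere E x0 (graph_dist E x x0))"
    by (rule finite_subset[OF _ finite_gball[OF assms, of x0 "graph_dist E x x0"]]) (auto simp: gsphere_def)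
  then show ?thesis
    unfolding max_valence_def by (intro Max_ge) (auto simp: gsphere_def)
qed

text \<open>Both vertices descend towards \<open>x0\<close> until the descents meet, at the latest
  in \<open>x0\<close>. This produces every cycle used below: containment in the ball keeps vertices
  farther out off the path, and three vertices are what \<open>is_cycle\<close> asks for.\<close>

lemma path_through_ball:
  assumes E: "infinite_graph E" and "a \<noteq> b" "graph_dist E a x0 = r" "graph_dist E b x0 = r"
  shows "\<exists>P. length P \<ge> 3 \<and> distinct P \<and> successively E P \<and> hd P = a \<and> last P = b \<and>
    set P \<subseteq> gball E x0 r"
  using assms(2-)
proof (induction r arbitrary: a b)
  case 0
  then show ?case
    by (simp add: graph_dist_eq_0[OF E])
next
  case (Suc r)
  obtain a' where a': "E a a'" "graph_dist E a' x0 = r"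
    using graph_dist_pred[OF E Suc.prems(2)] .
  obtain b' where b': "E b b'" "graph_dist E b' x0 = r"
    using graph_dist_pred[OF E Suc.prems(3)] .
  have b'b: "E b' b"
    by (rule infinite_graph_sym[OF E b'(1)])
  show ?case
  proof (cases "a' = b'")
    case True
    have "a \<noteq> a'" "a' \<noteq> b"
      using Suc.prems(2,3) a'(2) by (metis n_not_Suc_n)+
    then show ?thesis
      using True Suc.prems a'(1) eq_refl[OF a'(2)] b'b by (intro exI[of _ "[a, a', b]"]) simp
  next
    case False
    then obtain P where P: "length P \<ge> 3" "distinct P" "successively E P" "hd P = a'" "last P = b'"
        "set P \<subseteq> gball E x0 r"
      using Suc.IH[OF False a'(2) b'(2)] by blast
    then have ball: "graph_dist E v x0 \<le> r" if "v \<in> set P" for v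
      using that by blast
    then have "a \<notin> set P" "b \<notin> set P"
      using Suc.prems(2,3) by (metis Suc_n_not_le_n)+
    then show ?thesis
      using P(1-5) le_SucI[OF ball] Suc.prems a'(1) b'b
      by (intro exI[of _ "a # P @ [b]"])
        (auto simp: successively_Cons successively_append_iff hd_append)
  qed
qed

text \<open>Along an edge the distance changes by at most 1; if it did not change, the edge would
  close a path inside the ball to a cycle.\<close>

lemma tree_nbr_dist:
  assumes tree: "infinite_tree E" and "E x y" "graph_dist E x x0 = Suc r"
  shows "graph_dist E y x0 = r \<or> graph_dist E y x0 = Suc (Suc r)"
proof -
  have E: "infinite_graph E" and acyclic: "\<nexists>c. is_cycle E c"
    using tree by (auto simp: infinite_tree_def)
  have sym: "E y x" and "x \<noteq> y"
    using infinite_graph_sym[OF E \<open>E x y\<close>] infinite_graph_irrefl[OF E \<open>E x y\<close>] by auto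
  have "graph_dist E y x0 \<noteq> Suc r"
  proof
    assume "graph_dist E y x0 = Suc r"
    then obtain P where "length P \<ge> 3" "distinct P" "successively E P" "hd P = x" "last P = y"
      using path_through_ball[OF E \<open>x \<noteq> y\<close> assms(3)] by blast
    then have "is_cycle E P"
      using sym by (simp add: is_cycle_def)
    then show False
      using acyclic by blast
  qed
  then show ?thesis
    using graph_dist_nbr[OF E \<open>E x y\<close>, of x0] graph_dist_nbr[OF E sym, of x0] assms(3) by linarith
qed

text \<open>Two parents are joined by a path inside the ball of radius \<open>r\<close>;
  \<open>x\<close> lies outside that ball and is adjacent to both ends, which gives a cycle.\<close>

lemma tree_parent_unique:
  assumes tree: "infinite_tree E" and x: "graph_dist E x x0 = Suc r"
    and y: "E x y" "graph_dist E y x0 = r" and z: "E x z" "graph_dist E z x0 = r"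
  shows "y = z"
proof (rule ccontr)
  assume "y \<noteq> z"
  have E: "infinite_graph E" and acyclic: "\<nexists>c. is_cycle E c"
    using tree by (auto simp: infinite_tree_def)
  have "E z x"
    by (rule infinite_graph_sym[OF E z(1)])
  obtain P where P: "length P \<ge> 3" "distinct P" "successively E P" "hd P = y" "last P = z"
      "set P \<subseteq> gball E x0 r"
    using path_through_ball[OF E \<open>y \<noteq> z\<close> y(2) z(2)] by blast
  then have "x \<notin> set P"
    using x Suc_n_not_le_n by fastforce
  then have "is_cycle E (x # P)"
    using P \<open>E z x\<close> y(1) by (auto simp: is_cycle_def successively_Cons)
  then show False
    using acyclic by blast
qed

text \<open>One neighbour is the parent at distance r; the other m(x) - 1 are children at distance r
  + 2.\<close>

lemma tree_laplacian_radial: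
  assumes tree: "infinite_tree E" and x: "graph_dist E x x0 = Suc r"
  shows "laplacian E (\<lambda>z. g (graph_dist E z x0)) x
    = (g (Suc r) - g r) + (real (valence E x) - 1) * (g (Suc r) - g (Suc (Suc r)))"
proof -
  have E: "infinite_graph E"
    using tree by (simp add: infinite_tree_def)
  have fin: "finite (nbrs E x)"
    using E by (simp add: infinite_graph_def)
  obtain y where y: "E x y" "graph_dist E y x0 = r"
    using graph_dist_pred[OF E x] .
  then have mem: "y \<in> nbrs E x"
    by (simp add: nbrs_def)
  have far: "graph_dist E z x0 = Suc (Suc r)" if "z \<in> nbrs E x - {y}" for z
    using that tree_nbr_dist[OF tree _ x, of z] tree_parent_unique[OF tree x y, of z]
    by (auto simp: nbrs_def)
  \<comment> \<open>Positivity makes truncated subtraction in the cardinality agree with real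
    subtraction.\<close>
  have "valence E x \<ge> 1"
    using mem fin by (auto simp: valence_def Suc_le_eq card_gt_0_iff)
  then have "real (card (nbrs E x - {y})) = real (valence E x) - 1"
    using mem fin by (simp add: valence_def)
  moreover have "(\<Sum>z\<in>nbrs E x - {y}. g (Suc r) - g (graph_dist E z x0))
      = (\<Sum>z\<in>nbrs E x - {y}. g (Suc r) - g (Suc (Suc r)))"
    by (rule sum.cong[OF refl]) (simp only: far)
  ultimately show ?thesis
    unfolding laplacian_def sum.remove[OF fin mem] x y(2) by (simp only: sum_constant)
qed

lemma laplacian_radial_root:
  assumes E: "infinite_graph E"
  shows "laplacian E (\<lambda>z. g (graph_dist E z x0)) x0 = real (valence E x0) * (g 0 - g (Suc 0))"
proof -
  have 0: "graph_dist E x0 x0 = 0"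
    by (simp add: graph_dist_eq_0[OF E])
  have "graph_dist E z x0 = Suc 0" if "z \<in> nbrs E x0" for z
  proof -
    have "E x0 z"
      using that by (simp add: nbrs_def)
    then have "E z x0"
      by (rule infinite_graph_sym[OF E])
    then have "z \<noteq> x0"
      by (rule infinite_graph_irrefl[OF E])
    then show ?thesis
      using graph_dist_nbr[OF E \<open>E z x0\<close>, of x0] graph_dist_eq_0[OF E, of z x0] 0 by simp
  qed
  then show ?thesis
    unfolding laplacian_def valence_def using 0 by simp
qed

section \<open>Radial heat flow\<close>

text \<open>Minus the Laplacian of the model tree with branching function \<open>n\<close>, acting on radial functions.\<close>

definition radial_gen :: "(nat \<Rightarrow> nat) \<Rightarrow> (nat \<Rightarrow> real) \<Rightarrow> nat \<Rightarrow> real" where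
  "radial_gen n g r = (case r of 0 \<Rightarrow> real (n 0) * (g (Suc 0) - g 0)
     | Suc k \<Rightarrow> g k - g r + real (n r) * (g (Suc r) - g r))"

lemma model_tree_radial:
  assumes "model_tree E x0 n"
  shows "- laplacian E (\<lambda>z. g (graph_dist E z x0)) y = radial_gen n g (graph_dist E y x0)"
proof -
  have tree: "infinite_tree E" and E: "infinite_graph E"
    using assms by (auto simp: model_tree_def infinite_tree_def)
  obtain m where m: "\<And>x. valence E x = m (graph_dist E x x0)" "n 0 = m 0" "\<And>r. r > 0 \<Longrightarrow> n r + 1 = m r"
    using assms by (auto simp: model_tree_def gsphere_def)
  show ?thesis
  proof (cases "graph_dist E y x0")
    case 0
    then have "y = x0"
      by (simp add: graph_dist_eq_0[OF E])
    then show ?thesis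
      using 0 laplacian_radial_root[OF E, of g x0] m by (simp add: radial_gen_def algebra_simps)
  next
    case (Suc r)
    then have "real (valence E y) = real (n (Suc r)) + 1"
      using m(1)[of y] m(3)[of "Suc r"] by simp
    then show ?thesis
      using Suc tree_laplacian_radial[OF tree Suc, of g] by (simp add: radial_gen_def algebra_simps)
  qed
qed

text \<open>The inward terms agree. The outward difference g(r) - g(r+1) is nonnegative and has
  weight n(r) in the model but m(y) - 1 \<le> n(r) in the tree; at the root the weights are n(0) and
  m(y), where \<open>root\<close> applies.\<close>

lemma radial_gen_le_laplacian:
  assumes tree: "infinite_tree E" and anti: "\<And>r. g (Suc r) \<le> g r"
    and root: "max_valence E x0 0 \<le> n 0" and valences: "\<forall>r>0. max_valence E x0 r \<le> n r + 1"
  shows "radial_gen n g (graph_dist E y x0) \<le> - laplacian E (\<lambda>z. g (graph_dist E z x0)) y"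
proof -
  have E: "infinite_graph E"
    using tree by (simp add: infinite_tree_def)
  show ?thesis
  proof (cases "graph_dist E y x0")
    case 0
    then have "y = x0"
      by (simp add: graph_dist_eq_0[OF E])
    have "valence E y \<le> n 0"
      using valence_le_max_valence[OF E, of y x0] root 0 by simp
    then have "real (valence E y) * (g 0 - g (Suc 0)) \<le> real (n 0) * (g 0 - g (Suc 0))"
      using anti[of 0] by (intro mult_right_mono) auto
    then show ?thesis
      using 0 \<open>y = x0\<close> laplacian_radial_root[OF E, of g x0] by (simp add: radial_gen_def algebra_simps)
  next
    case (Suc r)
    have "valence E y \<le> n (Suc r) + 1"
      using valence_le_max_valence[OF E, of y x0] valences Suc by (metis le_trans zero_less_Suc)
    then have "(real (valence E y) - 1) * (g (Suc r) - g (Suc (Suc r)))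
        \<le> real (n (Suc r)) * (g (Suc r) - g (Suc (Suc r)))"
      using anti[of "Suc r"] by (intro mult_right_mono) auto
    then show ?thesis
      using Suc tree_laplacian_radial[OF tree Suc, of g] by (simp add: radial_gen_def algebra_simps)
  qed
qed

text \<open>The differences \<open>h\<close> obey a coupled linear system. At a positive maximum
  h(i) all terms have a good sign except n(i+1) h(i+1), which n(i) h(i) need not absorb because
  \<open>n\<close> may increase; it is at most C h(i), with C bounding \<open>n\<close> up to
  R.\<close>

lemma radial_flow_antimono:
  fixes \<rho> :: "real \<Rightarrow> nat \<Rightarrow> real"
  assumes deriv: "\<And>t r. t \<ge> 0 \<Longrightarrow> r \<le> R \<Longrightarrow>
      ((\<lambda>s. \<rho> s r) has_real_derivative radial_gen n (\<rho> t) r) (at t within {0..})"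
    and outside: "\<And>t r. r > R \<Longrightarrow> \<rho> t r = 0"
    and init: "\<And>r. \<rho> 0 r = (if r = 0 then 1 else 0)"
    and nonneg: "\<And>t r. t \<ge> 0 \<Longrightarrow> \<rho> t r \<ge> 0"
    and t: "t \<ge> 0"
  shows "\<rho> t (Suc r) \<le> \<rho> t r"
proof (cases "r < R")
  case True
  define C where "C = real (\<Sum>r\<le>R. n r)"
  have C: "real (n r) \<le> C" if "r \<le> R" for r
    unfolding C_def of_nat_le_iff using that by (intro member_le_sum) auto
  define h where "h r t = \<rho> t (Suc r) - \<rho> t r" for r t
  define D where "D r t = radial_gen n (\<rho> t) (Suc r) - radial_gen n (\<rho> t) r" for r t
  have D_0: "D 0 t = - h 0 t + n (Suc 0) * h (Suc 0) t - n 0 * h 0 t" for t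
    by (simp add: D_def h_def radial_gen_def)
  have D_Suc: "D (Suc k) t = - h (Suc k) t + n (Suc (Suc k)) * h (Suc (Suc k)) t + h k t - n (Suc k) * h (Suc k) t" for k t
    by (simp add: D_def h_def radial_gen_def)
  have "h r t \<le> 0"
  proof (rule finite_max_principle[where I = "{..<R}" and f = h and D = D and C = C])
    fix i t assume i: "i \<in> {..<R}" and t: "(t::real) \<ge> 0"
    show "(h i has_real_derivative D i t) (at t within {0..})"
      unfolding h_def D_def using i t by (intro DERIV_diff deriv) auto
    assume pos: "h i t > 0" and max: "\<And>j. j \<in> {..<R} \<Longrightarrow> h j t \<le> h i t"
    \<comment> \<open>At the last index, h(R) lies outside the system, but it equals -\<rho>(R)
      \<le> 0 because \<rho> vanishes beyond R.\<close>
    have "h (Suc i) t \<le> h i t"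
    proof (cases "Suc i < R")
      case False
      then have "Suc i = R"
        using i by simp
      then have "h (Suc i) t \<le> 0"
        using nonneg[OF t, of R] outside[of "Suc R" t] by (simp add: h_def)
      then show ?thesis
        using pos by simp
    qed (use max in auto)
    then have "real (n (Suc i)) * h (Suc i) t \<le> real (n (Suc i)) * h i t"
      by (intro mult_left_mono) auto
    also have "\<dots> \<le> C * h i t"
      using C[of "Suc i"] i pos by (intro mult_right_mono) auto
    finally have 1: "real (n (Suc i)) * h (Suc i) t \<le> C * h i t" .
    have 2: "real (n i) * h i t \<ge> 0"
      using pos by simp
    show "D i t \<le> C * h i t"
    proof (cases i)
      case 0
      then show ?thesis
        using 1 2 pos D_0[of t] unfolding 0 by linarith
    next
      case (Suc k)
      then have "h k t \<le> h i t"
        using max[of k] i by simp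
      then show ?thesis
        using 1 2 D_Suc[of k t] Suc by simp
    qed
  next
    fix i show "h i 0 \<le> 0"
      by (simp add: h_def init)
  qed (use True t in auto)
  then show ?thesis
    by (simp add: h_def)
next
  case False
  then show ?thesis
    using outside[of "Suc r" t] nonneg[OF t, of r] by simp
qed

text \<open>The flow is abstract and cut off at R, so the model enters only through
  \<open>n\<close>. Outside the ball of radius R in the tree the transplanted flow is 0 and
  \<open>p\<close> is nonnegative: the boundary condition of the maximum principle.\<close>

lemma radial_flow_le_heat_solution:
  fixes \<rho> :: "real \<Rightarrow> nat \<Rightarrow> real"
  assumes tree: "infinite_tree E" and sol: "heat_solution E p"
    and root: "max_valence E x0 0 \<le> n 0" and valences: "\<forall>r>0. max_valence E x0 r \<le> n r + 1"
    and deriv: "\<And>t r. t \<ge> 0 \<Longrightarrow> r \<le> R \<Longrightarrow>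
      ((\<lambda>s. \<rho> s r) has_real_derivative radial_gen n (\<rho> t) r) (at t within {0..})"
    and outside: "\<And>t r. r > R \<Longrightarrow> \<rho> t r = 0"
    and init: "\<And>r. \<rho> 0 r = (if r = 0 then 1 else 0)"
    and nonneg: "\<And>t r. t \<ge> 0 \<Longrightarrow> \<rho> t r \<ge> 0"
    and t: "t \<ge> 0"
  shows "\<rho> t (graph_dist E x x0) \<le> p t x0 x"
proof -
  have E: "infinite_graph E"
    using tree by (simp add: infinite_tree_def)
  have p_deriv: "((\<lambda>s. p s x0 y) has_real_derivative - laplacian E (p t x0) y) (at t within {0..})"
    and p_nonneg: "p t x0 y \<ge> 0" if "t \<ge> 0" for t y
    using sol that unfolding heat_solution_def by blast+
  have p_init: "p 0 x0 y = (if x0 = y then 1 else 0)" for y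
    using sol unfolding heat_solution_def by blast
  have "\<rho> t (graph_dist E x x0) - p t x0 x \<le> 0"
  proof (rule dirichlet_max_principle[where E = E and B = "gball E x0 R"
        and f = "\<lambda>t x. \<rho> t (graph_dist E x x0) - p t x0 x"
        and D = "\<lambda>t x. radial_gen n (\<rho> t) (graph_dist E x x0) - - laplacian E (p t x0) x"])
    show "finite (gball E x0 R)"
      by (rule finite_gball[OF E])
  next
    fix t :: real and y assume "t \<ge> 0" "y \<in> gball E x0 R"
    then show "((\<lambda>s. \<rho> s (graph_dist E y x0) - p s x0 y) has_real_derivative
        radial_gen n (\<rho> t) (graph_dist E y x0) - - laplacian E (p t x0) y) (at t within {0..})"
      by (intro DERIV_diff deriv p_deriv) auto
    have "\<rho> t (Suc r) \<le> \<rho> t r" for r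
      by (rule radial_flow_antimono[OF deriv outside init nonneg \<open>t \<ge> 0\<close>])
    then have "radial_gen n (\<rho> t) (graph_dist E y x0) \<le> - laplacian E (\<lambda>z. \<rho> t (graph_dist E z x0)) y"
      by (rule radial_gen_le_laplacian[OF tree _ root valences])
    then show "radial_gen n (\<rho> t) (graph_dist E y x0) - - laplacian E (p t x0) y
        \<le> - laplacian E (\<lambda>y. \<rho> t (graph_dist E y x0) - p t x0 y) y"
      by (simp add: laplacian_diff)
  next
    fix t :: real and y assume "t \<ge> 0" "y \<notin> gball E x0 R"
    then show "\<rho> t (graph_dist E y x0) - p t x0 y \<le> 0"
      using outside[of "graph_dist E y x0" t] p_nonneg[of t y] by simp
  next
    fix y show "\<rho> 0 (graph_dist E y x0) - p 0 x0 y \<le> 0"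
      by (auto simp: init p_init graph_dist_eq_0[OF E])
  qed (rule t)
  then show ?thesis by simp
qed

text \<open>The point mass at the root is radial, and the generator of a ball preserves radial
  functions; this replaces an argument by automorphisms.\<close>

lemma model_dirichlet_coeff_radial:
  assumes model: "model_tree E x0 n"
  shows "\<exists>v. \<forall>y. dirichlet_coeff E (gball E x0 R) k x0 y = v (graph_dist E y x0)"
proof (induction k)
  case 0
  have E: "infinite_graph E"
    using model by (simp add: model_tree_def infinite_tree_def)
  show ?case
    by (rule exI[of _ "\<lambda>r. if r = 0 then 1 else 0"])
      (auto simp: dirichlet_coeff_0 graph_dist_eq_0[OF E] graph_dist_eq_0[OF E, THEN iffD2])
next
  case (Suc k)
  then obtain v where "dirichlet_coeff E (gball E x0 R) k x0 = (\<lambda>y. v (graph_dist E y x0))"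
    by auto
  then show ?case
    by (intro exI[of _ "\<lambda>r. if r \<le> R then radial_gen n v r else 0"])
      (simp add: dirichlet_coeff_Suc dirichlet_gen_def model_tree_radial[OF model])
qed

section \<open>Dirichlet kernels of the model tree as radial flows\<close>

lemma model_dirichlet_kernel_radial:
  assumes model: "model_tree E x0 n"
  obtains \<rho> where "\<And>t y. dirichlet_kernel E (gball E x0 R) t x0 y = \<rho> t (graph_dist E y x0)"
proof -
  obtain v where "\<And>k y. dirichlet_coeff E (gball E x0 R) k x0 y = v k (graph_dist E y x0)"
    using model_dirichlet_coeff_radial[OF model] by metis
  then show ?thesis
    by (intro that[of "\<lambda>t r. \<Sum>k. v k r / fact k * t ^ k"]) (simp add: dirichlet_kernel_def)
qed

lemma model_dirichlet_kernel_le: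
  assumes model: "model_tree En o0 n" and tree: "infinite_tree E" and sol: "heat_solution E p"
    and root: "max_valence E x0 0 \<le> n 0" and valences: "\<forall>r>0. max_valence E x0 r \<le> n r + 1"
    and t: "t \<ge> 0" and dist: "graph_dist En y o0 = graph_dist E x x0"
  shows "dirichlet_kernel En (gball En o0 R) t o0 y \<le> p t x0 x"
proof -
  have En: "infinite_graph En"
    using model by (simp add: model_tree_def infinite_tree_def)
  note fin = finite_gball[OF En, of o0 R]
  obtain \<rho> where \<rho>: "\<And>t y. dirichlet_kernel En (gball En o0 R) t o0 y = \<rho> t (graph_dist En y o0)"
    using model_dirichlet_kernel_radial[OF model] by blast
  \<comment> \<open>One vertex per sphere, through which \<rho> inherits the equation, cutoff and
    sign at every radius. This \<open>y\<close> shadows the vertex of the statement.\<close>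
  obtain y where y: "\<And>r. graph_dist En (y r) o0 = r"
    using gsphere_nonempty[OF En] by metis
  have "\<rho> t (graph_dist E x x0) \<le> p t x0 x"
  proof (rule radial_flow_le_heat_solution[OF tree sol root valences _ _ _ _ t])
    fix t :: real and r assume "r \<le> R"
    then have "((\<lambda>s. dirichlet_kernel En (gball En o0 R) s o0 (y r)) has_real_derivative
        - laplacian En (dirichlet_kernel En (gball En o0 R) t o0) (y r)) (at t within {0..})"
      by (intro dirichlet_kernel_heat[OF fin]) (simp add: y)
    moreover have "dirichlet_kernel En (gball En o0 R) t o0 = (\<lambda>z. \<rho> t (graph_dist En z o0))"
      by (rule ext) (rule \<rho>)
    ultimately show "((\<lambda>s. \<rho> s r) has_real_derivative radial_gen n (\<rho> t) r) (at t within {0..})"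
      using model_tree_radial[OF model, of "\<rho> t" "y r"] by (simp add: \<rho> y)
  next
    fix t :: real and r assume "R < r"
    then show "\<rho> t r = 0"
      using \<rho>[of t "y r"] dirichlet_kernel_outside[of "y r" "gball En o0 R" En t o0] by (simp add: y)
  next
    fix r
    have "o0 = y r \<longleftrightarrow> r = 0"
      using graph_dist_eq_0[OF En, of "y r" o0] y[of r] by auto
    then show "\<rho> 0 r = (if r = 0 then 1 else 0)"
      using \<rho>[of 0 "y r"] by (auto simp: y dirichlet_kernel_0)
  next
    fix t :: real and r assume "t \<ge> 0"
    then show "\<rho> t r \<ge> 0"
      using \<rho>[of t "y r"] dirichlet_kernel_nonneg[OF fin, of t En o0 "y r"] by (simp add: y)
  qed
  then show ?thesis
    by (simp add: \<rho> dist)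
qed

theorem theorem3p5p1:
  fixes E :: "'a adjacency" and x0 :: 'a and p :: "real \<Rightarrow> 'a \<Rightarrow> 'a \<Rightarrow> real"
    and En :: "'b adjacency" and o0 :: 'b and n :: "nat \<Rightarrow> nat"
    and pn :: "real \<Rightarrow> 'b \<Rightarrow> 'b \<Rightarrow> real"
  assumes tree: "infinite_tree E" and kernel: "heat_kernel E p"
    and model: "model_tree En o0 n" and kernel_n: "heat_kernel En pn"
    and root: "max_valence E x0 0 \<le> n 0"
    and valences: "\<forall>r>0. max_valence E x0 r \<le> n r + 1"
  shows "\<forall>t\<ge>0. \<forall>r. \<forall>x \<in> gsphere E x0 r. radial_heat_kernel En o0 pn t r \<le> p t x0 x"
proof (intro allI impI ballI)
  fix t :: real and r x assume t: "t \<ge> 0" and "x \<in> gsphere E x0 r"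
  then have x: "graph_dist E x x0 = r"
    by (simp add: gsphere_def)
  have En: "infinite_graph En"
    using model by (simp add: model_tree_def infinite_tree_def)
  have "incseq (gball En o0)" "(\<Union>R. gball En o0 R) = UNIV"
    by (auto simp: incseq_def)
  then have lim: "(\<lambda>R. dirichlet_kernel En (gball En o0 R) t o0 y) \<longlonglongrightarrow> pn t o0 y" for y
    using En by (intro heat_kernel_exhaustion[OF kernel_n _ _ finite_gball[OF En] _ _ t])
      (auto simp: infinite_graph_def)
  \<comment> \<open>The definite description in \<open>radial_heat_kernel\<close> needs one common
    value on the sphere; it is inherited from the Dirichlet kernels in the limit.\<close>
  have radial: "pn t o0 y = pn t o0 z" if "graph_dist En y o0 = graph_dist En z o0" for y z
  proof -
    have "dirichlet_kernel En (gball En o0 R) t o0 y = dirichlet_kernel En (gball En o0 R) t o0 z" for R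
      using model_dirichlet_kernel_radial[OF model, of R] that by metis
    then show ?thesis
      using lim[of y] lim[of z] LIMSEQ_unique by simp
  qed
  obtain y where y: "graph_dist En y o0 = r"
    using gsphere_nonempty[OF En] by blast
  have "radial_heat_kernel En o0 pn t r = pn t o0 y"
    unfolding radial_heat_kernel_def using y radial
    by (intro the_equality) (auto simp: gsphere_def)
  also have "\<dots> \<le> p t x0 x"
    using kernel model_dirichlet_kernel_le[OF model tree _ root valences t, of p y x] x y
    by (intro LIMSEQ_le_const2[OF lim]) (auto simp: heat_kernel_def)
  finally show "radial_heat_kernel En o0 pn t r \<le> p t x0 x" .
qed

end
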